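(* Let $d\ge 1$ and let $\mathcal T\in\mathfrak T_{2,d}$ be a binary one-stage tree of depth $d$. Then $\mathcal T$ has toric structure and is parametrised by the Veronese algebra $\operatorname{im}\nu_{2,d}$, i.e. $\operatorname{im}\varphi_{\mathcal T}=\operatorname{im}\nu_{2,d}$ under the identification $\mathbb R[\theta_1,\theta_2,z]/\langle\theta_1+\theta_2-z\rangle\cong\mathbb R[\theta_1,\theta_2]$.
   Context: A one-stage tree with parameters $\theta_1,\dots,\theta_k$ is a finite rooted tree, edges directed away from the root, in which every inner vertex $v$ has exactly $k$ children $v_1,\dots,v_k$ and the edge $(v,v_i)$ is labelled $\theta_i$. Its depth is the number of edges of a longest root-to-leaf path. $\mathfrak T_{k,d}$ is the set of all one-stage trees of depth $d$ with parameters $\theta_1,\dots,\theta_k$; a binary one-stage tree is one with $k=2$. Let $\mathcal T\in\mathfrak T_{k,d}$ have root-to-leaf paths $\lambda_1,\dots,\lambda_n$; $E(\lambda_r)$ is the set of edges of $\lambda_r$, $\theta(e)$ the label of an edge $e$, $d(\lambda_r)=|E(\lambda_r)|$. Let $\Theta=\{\theta_1,\dots,\theta_k\}$, $z$ an extra variable, and $\langle\theta-z\rangle=\langle\theta_1+\dots+\theta_k-z\rangle\subset\mathbb R[\Theta,z]$. Define the $\mathbb R$-algebra map $$\varphi_{\mathcal T}:\mathbb R[p_1,\dots,p_n]\to\mathbb R[\Theta,z]/\langle\theta-z\rangle,\qquad p_r\mapsto z^{d-d(\lambda_r)}\prod_{e\in E(\lambda_r)}\theta(e).$$ The target is identified with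 $\mathbb R[\Theta]$ via $z=\theta_1+\dots+\theta_k$. The Veronese embedding is the map $\nu_{k,d}:\mathbb R[q_{\boldsymbol i}\mid \boldsymbol i\in\mathbb Z_{\ge0}^k,\ i_1+\dots+i_k=d]\to\mathbb R[\Theta]$, $q_{\boldsymbol i}\mapsto\theta^{\boldsymbol i}=\theta_1^{i_1}\cdots\theta_k^{i_k}$; its image $\operatorname{im}\nu_{k,d}$ is the Veronese algebra. $\mathcal T$ has toric structure if $\ker\varphi_{\mathcal T}$ is toric after a linear change of variables, i.e. there is a basis $\ell_1,\dots,\ell_n$ of the space of linear forms of $\mathbb R[p_1,\dots,p_n]$ such that $\ker\varphi_{\mathcal T}$ is the kernel of an $\mathbb R$-algebra map $\mathbb R[\ell_1,\dots,\ell_n]\to\mathbb R[y_1^{\pm1},\dots,y_N^{\pm1}]$ sending each $\ell_i$ to a Laurent monomial. *)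

theory Defs
  imports "HOL-Algebra.QuotRing" "HOL-Library.Poly_Mapping" Complex_Main
begin

section \<open>Polynomial rings\<close>

text \<open>
  A polynomial over the reals is a finitely supported map from exponent vectors to
  coefficients. Exponents in \<^typ>\<open>nat\<close> give ordinary polynomials, exponents in
  \<^typ>\<open>int\<close> give Laurent polynomials. The variables may be drawn from any type;
  \<open>poly_ring V\<close> and \<open>laurent_ring V\<close> only use those in \<open>V\<close>.
\<close>

type_synonym 'v mpoly = "('v \<Rightarrow>\<^sub>0 nat) \<Rightarrow>\<^sub>0 real"
type_synonym 'v lpoly = "('v \<Rightarrow>\<^sub>0 int) \<Rightarrow>\<^sub>0 real"

definition exp_ring :: "'v set \<Rightarrow> (('v \<Rightarrow>\<^sub>0 'e::comm_monoid_add) \<Rightarrow>\<^sub>0 real) ring" where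
  "exp_ring V =
     \<lparr>carrier = {f. \<forall>m\<in>Poly_Mapping.keys f. Poly_Mapping.keys m \<subseteq> V},
      mult = (*), one = 1, zero = 0, add = (+)\<rparr>"

abbreviation poly_ring :: "'v set \<Rightarrow> 'v mpoly ring" where
  "poly_ring \<equiv> exp_ring"

abbreviation laurent_ring :: "'v set \<Rightarrow> 'v lpoly ring" where
  "laurent_ring \<equiv> exp_ring"

definition const :: "real \<Rightarrow> ('m::zero \<Rightarrow>\<^sub>0 real)" where
  "const c = Poly_Mapping.single 0 c"

definition var :: "'v \<Rightarrow> 'v mpoly" where
  "var v = Poly_Mapping.single (Poly_Mapping.single v 1) 1"

text \<open>The \<open>\<real>\<close>-algebra map with \<open>v \<mapsto> g v\<close> on the variables.\<close>

definition alg_ext :: "('v \<Rightarrow> ('m::comm_monoid_add \<Rightarrow>\<^sub>0 real)) \<Rightarrow> 'v mpoly \<Rightarrow> ('m \<Rightarrow>\<^sub>0 real)" where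
  "alg_ext g f =
     (\<Sum>m\<in>Poly_Mapping.keys f. const (Poly_Mapping.lookup f m) *
        (\<Prod>v\<in>Poly_Mapping.keys m. g v ^ Poly_Mapping.lookup m v))"

definition alg_hom ::
    "('m::zero \<Rightarrow>\<^sub>0 real) ring \<Rightarrow> ('l::zero \<Rightarrow>\<^sub>0 real) ring \<Rightarrow> (('m \<Rightarrow>\<^sub>0 real) \<Rightarrow> ('l \<Rightarrow>\<^sub>0 real)) set" where
  "alg_hom R S = {h \<in> ring_hom R S. \<forall>c. h (const c) = const c}"

interpretation mpoly: vector_space "\<lambda>c (f :: 'v mpoly). const c * f"
  by unfold_locales
    (simp_all add: const_def algebra_simps single_add mult_single flip: mult.assoc)


section \<open>One-stage trees\<close>

text \<open>
  A tree is its list of subtrees below the root, the edge to the child at list position \<open>i\<close>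
  being labelled \<open>\<theta>\<^sub>i\<close>; indices start at \<open>0\<close>. A root-to-leaf path is
  represented by the list of the indices of its edge labels.
\<close>

datatype tree = Leaf | Node "tree list"

fun one_stage :: "nat \<Rightarrow> tree \<Rightarrow> bool" where
  "one_stage k Leaf \<longleftrightarrow> True"
| "one_stage k (Node ts) \<longleftrightarrow> length ts = k \<and> (\<forall>t\<in>set ts. one_stage k t)"

primrec paths :: "tree \<Rightarrow> nat list list" where
  "paths Leaf = [[]]"
| "paths (Node ts) =
     concat (map2 (\<lambda>i ps. map ((#) i) ps) [0..<length ts] (map paths ts))"

definition depth :: "tree \<Rightarrow> nat" where
  "depth T = Max (length ` set (paths T))"

definition one_stage_trees :: "nat \<Rightarrow> nat \<Rightarrow> tree set" where
  "one_stage_trees k d = {T. one_stage k T \<and> depth T = d}"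


section \<open>The parametrisation of a one-stage tree\<close>

datatype param = Theta nat | Z

definition theta :: "nat \<Rightarrow> param mpoly" where
  "theta i = var (Theta i)"

definition ring_Theta :: "nat \<Rightarrow> param mpoly ring" where
  "ring_Theta k = poly_ring (Theta ` {..<k})"

definition ring_Theta_Z :: "nat \<Rightarrow> param mpoly ring" where
  "ring_Theta_Z k = poly_ring (insert Z (Theta ` {..<k}))"

definition theta_ideal :: "nat \<Rightarrow> param mpoly set" where
  "theta_ideal k = genideal (ring_Theta_Z k) {(\<Sum>i<k. theta i) - var Z}"

definition target_ring :: "nat \<Rightarrow> param mpoly set ring" where
  "target_ring k = ring_Theta_Z k Quot theta_ideal k"

text \<open>The polynomial ring in \<open>p\<^sub>0, \<dots>, p\<^sub>n\<^sub>-\<^sub>1\<close>, one variable for each of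
  the \<open>n\<close> root-to-leaf paths.\<close>

definition ring_p :: "nat \<Rightarrow> nat mpoly ring" where
  "ring_p n = poly_ring {..<n}"

definition num_paths :: "tree \<Rightarrow> nat" where
  "num_paths T = length (paths T)"

definition phi :: "nat \<Rightarrow> tree \<Rightarrow> nat mpoly \<Rightarrow> param mpoly set" where
  "phi k T f =
     theta_ideal k +>\<^bsub>ring_Theta_Z k\<^esub>
       alg_ext (\<lambda>r. let p = paths T ! r in
           var Z ^ (depth T - length p) * (\<Prod>i\<leftarrow>p. theta i)) f"

text \<open>
  The identification of the target of \<open>phi\<close> with \<open>\<real>[\<Theta>]\<close>: the map on
  cosets induced by the substitution of the sum of the \<open>\<theta>\<^sub>i\<close> for \<open>z\<close>, which is
  constant on each coset.
\<close>

definition subst_Z :: "nat \<Rightarrow> param mpoly \<Rightarrow> param mpoly" where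
  "subst_Z k = alg_ext (\<lambda>v. case v of Theta i \<Rightarrow> theta i | Z \<Rightarrow> (\<Sum>i<k. theta i))"

definition identify :: "nat \<Rightarrow> param mpoly set \<Rightarrow> param mpoly" where
  "identify k X = the_elem (subst_Z k ` X)"


section \<open>The Veronese algebra\<close>

definition multi_indices :: "nat \<Rightarrow> nat \<Rightarrow> nat list set" where
  "multi_indices k d = {i. length i = k \<and> sum_list i = d}"

definition veronese :: "nat \<Rightarrow> nat list mpoly \<Rightarrow> param mpoly" where
  "veronese k = alg_ext (\<lambda>i. \<Prod>j<k. theta j ^ (i ! j))"

definition veronese_algebra :: "nat \<Rightarrow> nat \<Rightarrow> param mpoly set" where
  "veronese_algebra k d = veronese k ` carrier (poly_ring (multi_indices k d))"


section \<open>Toric structure\<close>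

definition linear_forms :: "nat \<Rightarrow> nat mpoly set" where
  "linear_forms n = mpoly.span (var ` {..<n})"

definition linear_forms_basis :: "nat \<Rightarrow> (nat \<Rightarrow> nat mpoly) \<Rightarrow> bool" where
  "linear_forms_basis n l \<longleftrightarrow>
     inj_on l {..<n} \<and> mpoly.independent (l ` {..<n}) \<and>
     mpoly.span (l ` {..<n}) = linear_forms n"

definition laurent_monomials :: "nat \<Rightarrow> nat lpoly set" where
  "laurent_monomials N = {Poly_Mapping.single m 1 | m. Poly_Mapping.keys m \<subseteq> {..<N}}"

text \<open>For a basis \<open>l\<close> of the linear forms, the polynomial ring in the \<open>l i\<close> is
  \<open>ring_p n\<close> itself.\<close>

definition toric_after_linear_change :: "nat \<Rightarrow> nat mpoly set \<Rightarrow> bool" where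
  "toric_after_linear_change n I \<longleftrightarrow>
     (\<exists>l N. linear_forms_basis n l \<and>
       (\<exists>\<psi> \<in> alg_hom (ring_p n) (laurent_ring {..<N}).
          (\<forall>i<n. \<psi> (l i) \<in> laurent_monomials N) \<and>
          I = a_kernel (ring_p n) (laurent_ring {..<N}) \<psi>))"

definition has_toric_structure :: "nat \<Rightarrow> tree \<Rightarrow> bool" where
  "has_toric_structure k T \<longleftrightarrow>
     toric_after_linear_change (num_paths T)
       (a_kernel (ring_p (num_paths T)) (target_ring k) (phi k T))"

end

theory Submission
  imports Defs
begin

text \<open>
  Replace \<open>z\<close> by \<open>s = \<theta>\<^sub>0 + \<theta>\<^sub>1\<close>. Each path \<open>p\<close> of a binary tree of depth \<open>d\<close> then becomes a binary
  form of degree \<open>d\<close>, namely \<open>s\<close> to the power \<open>d - length p\<close> times the product of the labels of \<open>p\<close>.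
  Since \<open>theta_ideal\<close> is exactly the kernel of this substitution (\<open>mem_theta_ideal_iff\<close>), the
  quotient ring can be replaced by polynomials in \<open>\<theta>\<^sub>0, \<theta>\<^sub>1\<close>.

  The heart of the matter is that these forms span the space of all binary forms of degree \<open>d\<close>
  (\<open>path_space_eq\<close>). One subtree at the root, say the one behind the edge \<open>a\<close>, has depth \<open>d - 1\<close>,
  and by induction its paths yield \<open>a\<close> times every form of degree \<open>d - 1\<close>. Only the
  monomial \<open>b\<close> to the power \<open>d\<close> is missing, where \<open>b\<close> labels the other edge. The forms belonging to
  the paths of the other subtree add up to \<open>b\<close> times \<open>s\<close> to the power \<open>d - 1\<close>, and this differs from
  the missing monomial by a multiple of \<open>a\<close>.

  Both claims follow. The path forms and the monomials of degree \<open>d\<close> have the same span, hence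
  generate the same algebra (\<open>alg_ext_image_eq_if_span_eq\<close>), which is the Veronese algebra. And
  because the linear forms in the \<open>p\<^sub>r\<close> are mapped onto the span of monomials, they have a basis whose
  elements are all mapped to monomials (\<open>toric_if_image_spanned_by_monomials\<close>); in the coordinates
  given by this basis the kernel is that of a monomial map.
\<close>

section \<open>Polynomial and Laurent polynomial rings\<close>

lemma sum_single_lookup:
  assumes "finite A" "Poly_Mapping.keys f \<subseteq> A"
  shows "(\<Sum>k\<in>A. Poly_Mapping.single k (Poly_Mapping.lookup f k)) = f"
proof (rule poly_mapping_eqI)
  fix k
  have "(\<Sum>l\<in>A. Poly_Mapping.lookup (Poly_Mapping.single l (Poly_Mapping.lookup f l)) k)
      = (\<Sum>l\<in>A. if l = k then Poly_Mapping.lookup f k else 0)"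
    by (rule sum.cong) (auto simp: lookup_single when_def)
  also have "\<dots> = Poly_Mapping.lookup f k"
    using assms by (auto simp: in_keys_iff)
  finally show "Poly_Mapping.lookup (\<Sum>l\<in>A. Poly_Mapping.single l (Poly_Mapping.lookup f l)) k
      = Poly_Mapping.lookup f k"
    by (simp add: lookup_sum)
qed

lemma const_zero [simp]: "const 0 = 0"
  and const_one [simp]: "const 1 = 1"
  by (simp_all add: const_def)

lemma const_add: "const (a + b) = const a + const b"
  by (simp add: const_def single_add)

lemma const_minus: "const (- a) = - const a"
  by (simp add: const_def single_uminus)

lemma const_mult: "const (a * b) = const a * (const b :: 'm::monoid_add \<Rightarrow>\<^sub>0 real)"
  by (simp add: const_def mult_single)

lemma const_of_nat: "const (of_nat k) = of_nat k"
  by (simp add: const_def)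

lemma exp_ring_carrier:
  "f \<in> carrier (exp_ring V) \<longleftrightarrow> (\<forall>m\<in>Poly_Mapping.keys f. Poly_Mapping.keys m \<subseteq> V)"
  by (simp add: exp_ring_def)

lemma exp_ring_simps [simp]:
  "x \<otimes>\<^bsub>exp_ring V\<^esub> y = x * y" "x \<oplus>\<^bsub>exp_ring V\<^esub> y = x + y"
  "\<one>\<^bsub>exp_ring V\<^esub> = 1" "\<zero>\<^bsub>exp_ring V\<^esub> = 0"
  by (simp_all add: exp_ring_def)

lemma exp_ring_single: "Poly_Mapping.keys m \<subseteq> V \<Longrightarrow> Poly_Mapping.single m c \<in> carrier (exp_ring V)"
  by (simp add: exp_ring_carrier)

lemma exp_ring_const [simp]: "const c \<in> carrier (exp_ring V)"
  by (simp add: const_def exp_ring_single)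

lemma exp_ring_zero [simp]: "0 \<in> carrier (exp_ring V)"
  and exp_ring_one [simp]: "1 \<in> carrier (exp_ring V)"
  by (simp_all add: exp_ring_carrier)

lemma exp_ring_var: "v \<in> V \<Longrightarrow> var v \<in> carrier (exp_ring V)"
  by (simp add: var_def exp_ring_single)

lemma exp_ring_add:
  "f \<in> carrier (exp_ring V) \<Longrightarrow> g \<in> carrier (exp_ring V) \<Longrightarrow> f + g \<in> carrier (exp_ring V)"
  using keys_add[of f g] by (fastforce simp: exp_ring_carrier)

lemma exp_ring_mult:
  assumes "f \<in> carrier (exp_ring V)" "g \<in> carrier (exp_ring V)"
  shows "f * g \<in> carrier (exp_ring V)"
  unfolding exp_ring_carrier
proof
  fix m assume "m \<in> Poly_Mapping.keys (f * g)"
  then obtain a b where "m = a + b" "a \<in> Poly_Mapping.keys f" "b \<in> Poly_Mapping.keys g"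
    using keys_mult[of f g] by blast
  then show "Poly_Mapping.keys m \<subseteq> V"
    using assms keys_add[of a b] unfolding exp_ring_carrier by blast
qed

lemma exp_ring_uminus: "f \<in> carrier (exp_ring V) \<Longrightarrow> - f \<in> carrier (exp_ring V)"
  by (simp add: exp_ring_carrier in_keys_iff)

lemma exp_ring_sum:
  "(\<And>x. x \<in> A \<Longrightarrow> f x \<in> carrier (exp_ring V)) \<Longrightarrow> sum f A \<in> carrier (exp_ring V)"
  by (induction A rule: infinite_finite_induct) (auto intro: exp_ring_add)

lemma exp_ring_power: "f \<in> carrier (exp_ring V) \<Longrightarrow> f ^ n \<in> carrier (exp_ring V)"
  by (induction n) (auto intro: exp_ring_mult)

lemma exp_ring_prod_list:
  "(\<And>x. x \<in> set xs \<Longrightarrow> f x \<in> carrier (exp_ring V)) \<Longrightarrow>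
   prod_list (map f xs) \<in> carrier (exp_ring V)"
  by (induction xs) (auto intro: exp_ring_mult)

lemma cring_exp_ring: "cring (exp_ring V)"
proof (rule cringI)
  show "abelian_group (exp_ring V)"
    by (rule abelian_groupI)
      (auto intro: exp_ring_add simp: ac_simps intro!: bexI[of _ "- _"] exp_ring_uminus)
  show "comm_monoid (exp_ring V)"
    by (rule comm_monoidI) (auto intro: exp_ring_mult simp: ac_simps)
qed (simp add: distrib_right)

lemma exp_ring_induct [consumes 1, case_names single add]:
  assumes f: "f \<in> carrier (exp_ring V)"
    and single: "\<And>m c. Poly_Mapping.keys m \<subseteq> V \<Longrightarrow> P (Poly_Mapping.single m c)"
    and add: "\<And>f g. P f \<Longrightarrow> P g \<Longrightarrow> P (f + g)"
  shows "P f"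
proof -
  have "P (\<Sum>m\<in>A. Poly_Mapping.single m (Poly_Mapping.lookup f m))"
    if "finite A" "A \<subseteq> Poly_Mapping.keys f" for A
    using that
  proof (induction A)
    case empty
    show ?case using single[of 0 0] by simp
  next
    case (insert m A)
    then show ?case using f by (auto intro!: add single simp: exp_ring_carrier)
  qed
  from this[OF finite_keys order_refl] show ?thesis
    by (simp add: sum_single_lookup)
qed

lemma poly_ring_induct [consumes 1, case_names const var add mult]:
  assumes f: "f \<in> carrier (poly_ring V)"
    and const: "\<And>c. P (const c)" and var: "\<And>v. v \<in> V \<Longrightarrow> P (var v)"
    and add: "\<And>f g. P f \<Longrightarrow> P g \<Longrightarrow> P (f + g)"
    and mult: "\<And>f g. P f \<Longrightarrow> P g \<Longrightarrow> P (f * g)"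
  shows "P f"
  using f
proof (induction rule: exp_ring_induct)
  case (single m c)
  have mono: "P (Poly_Mapping.single (Poly_Mapping.single v n) 1)" if "v \<in> V" for v n
  proof (induction n)
    case 0
    show ?case using const[of 1] by simp
  next
    case (Suc n)
    have "Poly_Mapping.single (Poly_Mapping.single v (Suc n)) (1::real)
        = var v * Poly_Mapping.single (Poly_Mapping.single v n) 1"
      by (simp add: var_def mult_single flip: single_add)
    then show ?case using mult[OF var[OF that] Suc.IH] by metis
  qed
  have "P (Poly_Mapping.single (\<Sum>v\<in>A. Poly_Mapping.single v (Poly_Mapping.lookup m v)) 1)"
    if "finite A" "A \<subseteq> V" for A
    using that
  proof (induction A)
    case empty
    show ?case using const[of 1] by simp
  next
    case (insert v A)
    then show ?case
      using mult[OF mono[of v "Poly_Mapping.lookup m v"] insert.IH]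
      by (simp add: mult_single)
  qed
  from this[OF finite_keys single] have "P (Poly_Mapping.single m 1)"
    by (simp add: sum_single_lookup)
  from mult[OF const[of c] this] show ?case
    by (simp add: const_def mult_single)
qed (rule add)

section \<open>Evaluation homomorphisms\<close>

definition monom_eval :: "('v \<Rightarrow> ('m::comm_monoid_add \<Rightarrow>\<^sub>0 real)) \<Rightarrow> ('v \<Rightarrow>\<^sub>0 nat) \<Rightarrow> ('m \<Rightarrow>\<^sub>0 real)" where
  "monom_eval g m = (\<Prod>v\<in>Poly_Mapping.keys m. g v ^ Poly_Mapping.lookup m v)"

lemma monom_eval_superset:
  assumes "finite A" "Poly_Mapping.keys m \<subseteq> A"
  shows "monom_eval g m = (\<Prod>v\<in>A. g v ^ Poly_Mapping.lookup m v)"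
  unfolding monom_eval_def using assms
  by (intro prod.mono_neutral_left) (auto simp: in_keys_iff)

lemma monom_eval_zero [simp]: "monom_eval g 0 = 1"
  by (simp add: monom_eval_def)

lemma monom_eval_add: "monom_eval g (m + m') = monom_eval g m * monom_eval g m'"
proof -
  let ?A = "Poly_Mapping.keys m \<union> Poly_Mapping.keys m'"
  have "monom_eval g x = (\<Prod>v\<in>?A. g v ^ Poly_Mapping.lookup x v)" if "x \<in> {m, m', m + m'}" for x
    using that keys_add[of m m'] by (intro monom_eval_superset) auto
  then show ?thesis
    by (simp add: lookup_add power_add prod.distrib)
qed

lemma alg_ext_superset:
  assumes "finite A" "Poly_Mapping.keys f \<subseteq> A"
  shows "alg_ext g f = (\<Sum>m\<in>A. const (Poly_Mapping.lookup f m) * monom_eval g m)"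
  unfolding alg_ext_def monom_eval_def using assms
  by (intro sum.mono_neutral_left) (auto simp: in_keys_iff)

lemma alg_ext_add: "alg_ext g (f + f') = alg_ext g f + alg_ext g f'"
proof -
  let ?A = "Poly_Mapping.keys f \<union> Poly_Mapping.keys f'"
  have "alg_ext g x = (\<Sum>m\<in>?A. const (Poly_Mapping.lookup x m) * monom_eval g m)"
    if "x \<in> {f, f', f + f'}" for x
    using that keys_add[of f f'] by (intro alg_ext_superset) auto
  then show ?thesis
    by (simp add: lookup_add const_add distrib_right sum.distrib)
qed

lemma alg_ext_single: "alg_ext g (Poly_Mapping.single m c) = const c * monom_eval g m"
  by (subst alg_ext_superset[of "{m}"]) auto

lemma alg_ext_mult: "alg_ext g (f * f') = alg_ext g f * alg_ext g f'"
proof -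
  have "f \<in> carrier (exp_ring UNIV)" "f' \<in> carrier (exp_ring UNIV)"
    by (simp_all add: exp_ring_carrier)
  then show ?thesis
  proof (induction arbitrary: f' rule: exp_ring_induct)
    case (single m c)
    from single(2) show ?case
      by (induction rule: exp_ring_induct)
        (simp_all add: mult_single alg_ext_single const_mult monom_eval_add alg_ext_add
          distrib_left distrib_right mult_ac)
  qed (simp add: alg_ext_add distrib_right)
qed

lemma alg_ext_const [simp]: "alg_ext g (const c) = const c"
  by (simp add: const_def alg_ext_single[unfolded const_def])

lemma alg_ext_var [simp]: "alg_ext g (var v) = g v"
  by (simp add: var_def alg_ext_single monom_eval_def)

lemma alg_ext_zero [simp]: "alg_ext g 0 = 0"
  and alg_ext_one [simp]: "alg_ext g 1 = 1"
  using alg_ext_const[of g 0] alg_ext_const[of g 1] by simp_all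

lemma alg_ext_uminus: "alg_ext g (- f) = - alg_ext g f"
  using alg_ext_add[of g f "- f"] by (simp add: eq_neg_iff_add_eq_0 add.commute)

lemma alg_ext_diff: "alg_ext g (f - f') = alg_ext g f - alg_ext g f'"
  using alg_ext_add[of g f "- f'"] by (simp add: alg_ext_uminus)

lemma alg_ext_sum: "alg_ext g (sum h A) = (\<Sum>x\<in>A. alg_ext g (h x))"
  by (induction A rule: infinite_finite_induct) (simp_all add: alg_ext_add)

lemma alg_ext_power: "alg_ext g (f ^ n) = alg_ext g f ^ n"
  by (induction n) (simp_all add: alg_ext_mult)

lemma alg_ext_prod_list: "alg_ext g (prod_list (map h xs)) = prod_list (map (\<lambda>x. alg_ext g (h x)) xs)"
  by (induction xs) (simp_all add: alg_ext_mult)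

lemma alg_ext_comp: "alg_ext h (alg_ext g f) = alg_ext (\<lambda>v. alg_ext h (g v)) f"
proof -
  have "f \<in> carrier (exp_ring UNIV)" by (simp add: exp_ring_carrier)
  then show ?thesis
    by (induction rule: poly_ring_induct) (simp_all add: alg_ext_add alg_ext_mult)
qed

lemma alg_ext_in_carrier:
  assumes "f \<in> carrier (poly_ring V)" "\<And>v. v \<in> V \<Longrightarrow> g v \<in> carrier (exp_ring W)"
  shows "alg_ext g f \<in> carrier (exp_ring W)"
  using assms(1)
  by (induction rule: poly_ring_induct)
    (simp_all add: assms(2) alg_ext_add alg_ext_mult exp_ring_add exp_ring_mult)

lemma alg_ext_alg_hom:
  assumes "\<And>v. v \<in> V \<Longrightarrow> g v \<in> carrier (exp_ring W)"
  shows "alg_ext g \<in> alg_hom (poly_ring V) (exp_ring W)"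
  unfolding alg_hom_def
  by (auto intro!: ring_hom_memI alg_ext_in_carrier[OF _ assms] simp: alg_ext_add alg_ext_mult)

text \<open>
  The image of an evaluation homomorphism is the subalgebra generated by the values at the
  variables, so the inclusion only has to be tested on these values.
\<close>
lemma alg_ext_image_mono:
  assumes "\<And>v. v \<in> V \<Longrightarrow> g v \<in> alg_ext h ` carrier (poly_ring W)"
  shows "alg_ext g ` carrier (poly_ring V) \<subseteq> alg_ext h ` carrier (poly_ring W)"
proof safe
  fix f assume "f \<in> carrier (poly_ring V)"
  then show "alg_ext g f \<in> alg_ext h ` carrier (poly_ring W)"
  proof (induction rule: poly_ring_induct)
    case (const c)
    show ?case by (rule image_eqI[of _ _ "const c"]) simp_all
  next
    case (var v)
    then show ?case using assms by simp
  next
    case (add a b)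
    then obtain f' g' where "alg_ext g a = alg_ext h f'" "f' \<in> carrier (poly_ring W)"
      "alg_ext g b = alg_ext h g'" "g' \<in> carrier (poly_ring W)" by auto
    then show ?case
      by (intro image_eqI[of _ _ "f' + g'"]) (simp_all add: alg_ext_add exp_ring_add)
  next
    case (mult a b)
    then obtain f' g' where "alg_ext g a = alg_ext h f'" "f' \<in> carrier (poly_ring W)"
      "alg_ext g b = alg_ext h g'" "g' \<in> carrier (poly_ring W)" by auto
    then show ?case
      by (intro image_eqI[of _ _ "f' * g'"]) (simp_all add: alg_ext_mult exp_ring_mult)
  qed
qed

lemma span_subset_alg_ext_image:
  "mpoly.span (h ` W) \<subseteq> alg_ext h ` carrier (poly_ring W)"
proof
  fix x assume "x \<in> mpoly.span (h ` W)"
  then show "x \<in> alg_ext h ` carrier (poly_ring W)"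
  proof (induction rule: mpoly.span_induct_alt)
    case base
    show ?case by (rule image_eqI[of _ _ 0]) simp_all
  next
    case (step c x y)
    then obtain v f where "v \<in> W" "x = h v" "y = alg_ext h f" "f \<in> carrier (poly_ring W)"
      by auto
    then show ?case
      by (intro image_eqI[of _ _ "const c * var v + f"])
        (auto simp: alg_ext_add alg_ext_mult intro!: exp_ring_add exp_ring_mult exp_ring_var)
  qed
qed

text \<open>
  A subalgebra contains the linear span of its generators, so it depends on that span only.
  This turns the comparison of the two parametrised algebras into linear algebra.
\<close>
lemma alg_ext_image_eq_if_span_eq:
  assumes "mpoly.span (g ` V) = mpoly.span (h ` W)"
  shows "alg_ext g ` carrier (poly_ring V) = alg_ext h ` carrier (poly_ring W)"
proof
  show "alg_ext g ` carrier (poly_ring V) \<subseteq> alg_ext h ` carrier (poly_ring W)"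
    using assms span_subset_alg_ext_image[of h W]
    by (intro alg_ext_image_mono) (auto dest: mpoly.span_base[of _ "g ` V", OF imageI])
  show "alg_ext h ` carrier (poly_ring W) \<subseteq> alg_ext g ` carrier (poly_ring V)"
    using assms span_subset_alg_ext_image[of g V]
    by (intro alg_ext_image_mono) (auto dest: mpoly.span_base[of _ "h ` W", OF imageI])
qed

section \<open>Linear forms\<close>

lemma independent_var: "mpoly.independent (var ` A)"
proof
  assume "mpoly.dependent (var ` A)"
  then obtain v where v: "var v \<in> mpoly.span (var ` A - {var v})"
    unfolding mpoly.dependent_def by blast
  have "Poly_Mapping.lookup x (Poly_Mapping.single v 1) = 0"
    if "x \<in> mpoly.span (var ` A - {var v})" for x
    using that
  proof (induction rule: mpoly.span_induct_alt)
    case (step c x y)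
    then obtain w where w: "x = var w" "w \<noteq> v" by auto
    then have "Poly_Mapping.single w (1::nat) \<noteq> Poly_Mapping.single v 1"
      by (metis lookup_single_eq lookup_single_not_eq one_neq_zero)
    with step w show ?case
      by (simp add: lookup_add const_def var_def mult_single lookup_single_not_eq)
  qed simp
  from this[OF v] show False by (simp add: var_def)
qed

lemma inj_var: "inj_on var A"
proof (rule inj_onI)
  fix v w :: 'a assume "var v = var w"
  then have "Poly_Mapping.lookup (var w) (Poly_Mapping.single v 1) = 1"
    by (metis var_def lookup_single_eq)
  then have "Poly_Mapping.single v (1::nat) = Poly_Mapping.single w 1"
    unfolding var_def by (metis lookup_single_not_eq zero_neq_one)
  then show "v = w"
    by (metis lookup_single_eq lookup_single_not_eq one_neq_zero)
qed

text \<open>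
  Every spanning set of a vector space contains a basis, and every basis of the linear forms in
  \<open>n\<close> variables has \<open>n\<close> elements, because the variables form one.
\<close>
lemma ex_linear_forms_basis:
  assumes S: "mpoly.span S = linear_forms n"
  obtains l where "linear_forms_basis n l" "l ` {..<n} \<subseteq> S"
proof -
  obtain B where B: "B \<subseteq> S" "mpoly.independent B" "S \<subseteq> mpoly.span B"
    by (rule mpoly.maximal_independent_subset)
  have span: "mpoly.span B = linear_forms n"
    using B S by (metis mpoly.span_mono mpoly.span_minimal mpoly.subspace_span subset_antisym)
  have "finite B \<and> card B \<le> card (var ` {..<n})"
    using span by (intro mpoly.independent_span_bound B)
      (auto simp: linear_forms_def intro: mpoly.span_base)
  moreover from this have "card (var ` {..<n}) \<le> card B"
    using span mpoly.independent_span_bound[OF _ independent_var[of "{..<n}"], of B]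
    by (auto simp: linear_forms_def intro: mpoly.span_base)
  ultimately have "finite B" "card {..<n} = card B"
    by (auto simp: card_image[OF inj_var])
  then obtain l where "bij_betw l {..<n} B"
    using finite_same_card_bij[of "{..<n}" B] by auto
  then have "linear_forms_basis n l" "l ` {..<n} \<subseteq> S"
    using B span by (auto simp: linear_forms_basis_def bij_betw_def)
  then show thesis by (rule that)
qed

lemma alg_ext_linear_image:
  "alg_ext g ` mpoly.span A = mpoly.span (alg_ext g ` A)"
proof -
  interpret h: Vector_Spaces.linear "\<lambda>c f. const c * f" "\<lambda>c f. const c * f" "alg_ext g"
    by unfold_locales (simp_all add: alg_ext_add alg_ext_mult)
  show ?thesis by (rule h.span_image[symmetric])
qed

text \<open>
  The linear forms that evaluate into \<open>M\<close> already span all linear forms: each linear form differs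
  by a form \<open>k\<close> in the kernel from a combination of forms evaluating into \<open>M\<close>, and \<open>k = (s + k) - s\<close>
  for any form \<open>s\<close> evaluating into \<open>M\<close>. The last step handles the kernel without letting a basis
  element evaluate to \<open>0\<close>, which is not a monomial; it is the reason to ask for \<open>M \<noteq> {}\<close>.
\<close>
lemma toric_if_image_spanned_by_monomials:
  fixes g :: "nat \<Rightarrow> 'v mpoly"
  assumes span: "mpoly.span (g ` {..<n}) = mpoly.span M" and M: "M \<noteq> {}"
  obtains l where "linear_forms_basis n l" "\<And>i. i < n \<Longrightarrow> alg_ext g (l i) \<in> M"
proof -
  let ?L = "linear_forms n"
  define S where "S = {x \<in> ?L. alg_ext g x \<in> M}"
  have img: "alg_ext g ` ?L = mpoly.span M"
    by (simp add: linear_forms_def alg_ext_linear_image image_image span)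
  have sub: "mpoly.subspace ?L" by (simp add: linear_forms_def)
  have imS: "alg_ext g ` S = M"
  proof (intro equalityI subsetI)
    fix m assume "m \<in> M"
    then have "m \<in> alg_ext g ` ?L" by (simp add: img mpoly.span_base)
    with \<open>m \<in> M\<close> show "m \<in> alg_ext g ` S" by (auto simp: S_def)
  qed (auto simp: S_def)
  have "mpoly.span S = ?L"
  proof
    show "mpoly.span S \<subseteq> ?L"
      by (rule mpoly.span_minimal[OF _ sub]) (auto simp: S_def)
    show "?L \<subseteq> mpoly.span S"
    proof
      fix x assume x: "x \<in> ?L"
      then have "alg_ext g x \<in> alg_ext g ` mpoly.span S"
        using img imS by (auto simp: alg_ext_linear_image)
      then obtain y where y: "y \<in> mpoly.span S" "alg_ext g y = alg_ext g x" by auto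
      obtain s where s: "s \<in> S" using M imS by auto
      have "y \<in> ?L" using y(1) \<open>mpoly.span S \<subseteq> ?L\<close> by blast
      then have "s + (x - y) \<in> S"
        using s x y(2) sub
        by (auto simp: S_def alg_ext_add alg_ext_diff intro!: mpoly.subspace_add mpoly.subspace_diff)
      then have "(s + (x - y)) - s + y \<in> mpoly.span S"
        by (intro mpoly.span_add mpoly.span_diff mpoly.span_base s y(1))
      then show "x \<in> mpoly.span S" by simp
    qed
  qed
  then obtain l where "linear_forms_basis n l" "l ` {..<n} \<subseteq> S"
    by (rule ex_linear_forms_basis)
  then show thesis
    by (intro that[of l]) (auto simp: S_def)
qed

section \<open>Eliminating the extra variable\<close>

lemma subst_Z_var:
  "subst_Z k (theta i) = theta i" "subst_Z k (var Z) = (\<Sum>i<k. theta i)"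
  by (simp_all add: subst_Z_def theta_def)

lemma theta_in_carrier: "i < k \<Longrightarrow> theta i \<in> carrier (poly_ring (insert Z (Theta ` {..<k})))"
  by (auto simp: theta_def intro: exp_ring_var)

lemma ideal_theta_ideal: "ideal (theta_ideal k) (ring_Theta_Z k)"
  and theta_ideal_generator: "(\<Sum>i<k. theta i) - var Z \<in> theta_ideal k"
proof -
  interpret R: cring "ring_Theta_Z k" by (simp add: ring_Theta_Z_def cring_exp_ring)
  have "(\<Sum>i<k. theta i) + - var Z \<in> carrier (ring_Theta_Z k)"
    unfolding ring_Theta_Z_def
    by (intro exp_ring_add exp_ring_uminus exp_ring_sum theta_in_carrier exp_ring_var) auto
  then have "{(\<Sum>i<k. theta i) - var Z} \<subseteq> carrier (ring_Theta_Z k)" by simp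
  then show "ideal (theta_ideal k) (ring_Theta_Z k)" "(\<Sum>i<k. theta i) - var Z \<in> theta_ideal k"
    unfolding theta_ideal_def using R.genideal_self by (auto intro: R.genideal_ideal)
qed

text \<open>
  Substituting the sum of the \<open>\<theta>\<^sub>i\<close> for \<open>z\<close> kills the generator of the ideal. Conversely, modulo the
  ideal every variable is congruent to its substitute, hence so is every polynomial; a
  polynomial whose substitute vanishes is therefore congruent to zero.
\<close>
lemma mem_theta_ideal_iff:
  assumes f: "f \<in> carrier (ring_Theta_Z k)"
  shows "f \<in> theta_ideal k \<longleftrightarrow> subst_Z k f = 0"
proof -
  let ?R = "ring_Theta_Z k"
  interpret R: cring ?R by (simp add: ring_Theta_Z_def cring_exp_ring)
  interpret I: ideal "theta_ideal k" ?R by (rule ideal_theta_ideal)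
  have sum_carrier: "(\<Sum>i<k. theta i) \<in> carrier ?R"
    by (auto simp: ring_Theta_Z_def intro!: exp_ring_sum theta_in_carrier)
  have subst_carrier: "subst_Z k x \<in> carrier ?R" if "x \<in> carrier ?R" for x
    using that sum_carrier unfolding subst_Z_def ring_Theta_Z_def
    by (elim alg_ext_in_carrier) (auto intro: theta_in_carrier)
  have neg: "- x \<in> theta_ideal k" if "x \<in> theta_ideal k" for x
  proof -
    have "- x = const (-1) * x" by (simp add: const_minus)
    moreover have "const (-1) * x \<in> theta_ideal k"
      using I.I_l_closed[OF that, of "const (-1)"] by (simp add: ring_Theta_Z_def)
    ultimately show ?thesis by simp
  qed
  have "x \<in> carrier ?R \<and> x - subst_Z k x \<in> theta_ideal k" if "x \<in> carrier ?R" for x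
    using that unfolding ring_Theta_Z_def
  proof (induction rule: poly_ring_induct)
    case (const c)
    show ?case using I.zero_closed by (simp add: subst_Z_def ring_Theta_Z_def)
  next
    case (var v)
    show ?case
    proof (cases v)
      case (Theta i)
      then show ?thesis using var I.zero_closed subst_Z_var(1)[of k i]
        by (simp add: theta_def ring_Theta_Z_def exp_ring_var)
    next
      case Z
      then show ?thesis using neg[OF theta_ideal_generator]
        by (simp add: subst_Z_var exp_ring_var)
    qed
  next
    case (add a b)
    then have "(a - subst_Z k a) + (b - subst_Z k b) \<in> theta_ideal k"
      using I.a_closed by (simp add: ring_Theta_Z_def)
    then show ?case using add by (simp add: subst_Z_def alg_ext_add exp_ring_add algebra_simps)
  next
    case (mult a b)
    then have "b * (a - subst_Z k a) \<in> theta_ideal k" "subst_Z k a * (b - subst_Z k b) \<in> theta_ideal k"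
      using I.I_l_closed[of "a - subst_Z k a" b] I.I_l_closed[of "b - subst_Z k b" "subst_Z k a"]
        subst_carrier[of a]
      by (simp_all add: ring_Theta_Z_def)
    then have "b * (a - subst_Z k a) + subst_Z k a * (b - subst_Z k b) \<in> theta_ideal k"
      using I.a_closed by (simp add: ring_Theta_Z_def)
    then show ?case using mult by (simp add: subst_Z_def alg_ext_mult exp_ring_mult algebra_simps)
  qed
  then have "f - subst_Z k f \<in> theta_ideal k" using f by blast
  moreover have "subst_Z k f = 0" if "f \<in> theta_ideal k"
  proof -
    have hom: "ring_hom_ring ?R ?R (subst_Z k)"
      by (intro ring_hom_ringI2 R.ring_axioms ring_hom_memI subst_carrier)
        (simp_all add: ring_Theta_Z_def subst_Z_def alg_ext_add alg_ext_mult)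
    have "theta_ideal k \<subseteq> a_kernel ?R ?R (subst_Z k)"
      unfolding theta_ideal_def
      using I.Icarr[OF theta_ideal_generator]
      by (intro R.genideal_minimal ring_hom_ring.kernel_is_ideal[OF hom])
        (auto simp: a_kernel_def' subst_Z_def alg_ext_diff alg_ext_sum theta_def ring_Theta_Z_def)
    then show ?thesis using that by (auto simp: a_kernel_def' ring_Theta_Z_def)
  qed
  ultimately show ?thesis by auto
qed

lemma identify_coset:
  "identify k (theta_ideal k +>\<^bsub>ring_Theta_Z k\<^esub> f) = subst_Z k f"
proof -
  interpret R: cring "ring_Theta_Z k" by (simp add: ring_Theta_Z_def cring_exp_ring)
  interpret I: ideal "theta_ideal k" "ring_Theta_Z k" by (rule ideal_theta_ideal)
  have "subst_Z k (h + f) = subst_Z k f" if "h \<in> theta_ideal k" for h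
    using mem_theta_ideal_iff[OF I.Icarr[OF that]] that by (simp add: subst_Z_def alg_ext_add)
  moreover have "0 \<in> theta_ideal k"
    using I.zero_closed by (simp add: ring_Theta_Z_def)
  ultimately have "subst_Z k ` (theta_ideal k +>\<^bsub>ring_Theta_Z k\<^esub> f) = {subst_Z k f}"
    unfolding a_r_coset_def' by (force simp: ring_Theta_Z_def)
  then show ?thesis by (simp add: identify_def)
qed

lemma coset_eq_theta_ideal_iff:
  assumes "f \<in> carrier (ring_Theta_Z k)"
  shows "theta_ideal k +>\<^bsub>ring_Theta_Z k\<^esub> f = theta_ideal k \<longleftrightarrow> subst_Z k f = 0"
proof -
  interpret I: ideal "theta_ideal k" "ring_Theta_Z k" by (rule ideal_theta_ideal)
  have "theta_ideal k +>\<^bsub>ring_Theta_Z k\<^esub> f = theta_ideal k \<longleftrightarrow> f \<in> theta_ideal k"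
    using I.rcos_const_imp_mem[OF assms] I.a_rcos_zero[OF I.is_ideal]
    by (auto simp: FactRing_def)
  then show ?thesis by (simp add: mem_theta_ideal_iff[OF assms])
qed

section \<open>Embedding polynomials into Laurent polynomials\<close>

definition lvar :: "'v \<Rightarrow> 'v lpoly" where
  "lvar v = Poly_Mapping.single (Poly_Mapping.single v 1) 1"

lemma lvar_power: "lvar v ^ n = Poly_Mapping.single (Poly_Mapping.single v (int n)) 1"
  by (induction n) (simp_all add: lvar_def mult_single flip: single_add)

text \<open>
  Renaming the variables injectively maps distinct monomials to distinct Laurent monomials, so no
  cancellation can occur.
\<close>
lemma alg_ext_lvar_eq_zero_iff:
  assumes enc: "inj_on enc V" and f: "f \<in> carrier (poly_ring V)"
  shows "alg_ext (\<lambda>v. lvar (enc v)) f = 0 \<longleftrightarrow> f = 0"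
proof
  assume zero: "alg_ext (\<lambda>v. lvar (enc v)) f = 0"
  \<comment> \<open>The effect of the renaming on exponent vectors.\<close>
  define \<mu> :: "('a \<Rightarrow>\<^sub>0 nat) \<Rightarrow> ('b \<Rightarrow>\<^sub>0 int)" where
    "\<mu> m = (\<Sum>v\<in>Poly_Mapping.keys m. Poly_Mapping.single (enc v) (int (Poly_Mapping.lookup m v)))" for m
  have lookup_\<mu>: "Poly_Mapping.lookup (\<mu> m) (enc v) = int (Poly_Mapping.lookup m v)"
    if "Poly_Mapping.keys m \<subseteq> V" "v \<in> V" for m v
  proof -
    have "Poly_Mapping.lookup (\<mu> m) (enc v)
        = (\<Sum>w\<in>Poly_Mapping.keys m. if w = v then int (Poly_Mapping.lookup m v) else 0)"
      unfolding \<mu>_def lookup_sum using that enc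
      by (intro sum.cong) (auto simp: lookup_single when_def inj_on_eq_iff[OF enc] subset_iff)
    then show ?thesis by (simp add: in_keys_iff)
  qed
  have inj: "inj_on \<mu> {m. Poly_Mapping.keys m \<subseteq> V}"
  proof (rule inj_onI, rule poly_mapping_eqI)
    fix m m' v
    assume m: "m \<in> {m. Poly_Mapping.keys m \<subseteq> V}" "m' \<in> {m. Poly_Mapping.keys m \<subseteq> V}" "\<mu> m = \<mu> m'"
    show "Poly_Mapping.lookup m v = Poly_Mapping.lookup m' v"
    proof (cases "v \<in> V")
      case True
      then show ?thesis using m lookup_\<mu>[of m v] lookup_\<mu>[of m' v] by simp
    next
      case False
      then have "v \<notin> Poly_Mapping.keys m" "v \<notin> Poly_Mapping.keys m'" using m by auto
      then show ?thesis by (simp add: in_keys_iff)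
    qed
  qed
  have eval: "monom_eval (\<lambda>v. lvar (enc v)) m = Poly_Mapping.single (\<mu> m) 1" for m
  proof -
    have "(\<Prod>v\<in>A. Poly_Mapping.single (h v) (1::real)) = Poly_Mapping.single (\<Sum>v\<in>A. h v) 1"
      for A and h :: "'a \<Rightarrow> 'b \<Rightarrow>\<^sub>0 int"
      by (induction A rule: infinite_finite_induct) (simp_all add: mult_single)
    then show ?thesis by (simp add: monom_eval_def lvar_power \<mu>_def)
  qed
  have "Poly_Mapping.lookup f m = 0" for m
  proof (cases "m \<in> Poly_Mapping.keys f")
    case True
    have "0 = Poly_Mapping.lookup (alg_ext (\<lambda>v. lvar (enc v)) f) (\<mu> m)"
      by (simp add: zero)
    also have "\<dots> = (\<Sum>l\<in>Poly_Mapping.keys f. Poly_Mapping.lookup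
        (Poly_Mapping.single (\<mu> l) (Poly_Mapping.lookup f l)) (\<mu> m))"
      by (simp add: alg_ext_superset[of "Poly_Mapping.keys f"] eval lookup_sum const_def mult_single)
    also have "\<dots> = (\<Sum>l\<in>Poly_Mapping.keys f. if l = m then Poly_Mapping.lookup f m else 0)"
      using f True by (intro sum.cong)
        (auto simp: lookup_single when_def exp_ring_carrier inj_on_eq_iff[OF inj])
    finally show ?thesis using True by simp
  qed (simp add: in_keys_iff)
  then show "f = 0" by (intro poly_mapping_eqI) simp
qed simp

lemma laurent_monomials_mult:
  assumes "f \<in> laurent_monomials N" "g \<in> laurent_monomials N"
  shows "f * g \<in> laurent_monomials N"
proof -
  obtain m m' where "f = Poly_Mapping.single m 1" "Poly_Mapping.keys m \<subseteq> {..<N}"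
    "g = Poly_Mapping.single m' 1" "Poly_Mapping.keys m' \<subseteq> {..<N}"
    using assms by (auto simp: laurent_monomials_def)
  then show ?thesis using keys_add[of m m']
    by (auto simp: laurent_monomials_def mult_single intro!: exI[of _ "m + m'"])
qed

lemma lvar_power_laurent_monomial: "i < N \<Longrightarrow> lvar i ^ n \<in> laurent_monomials N"
  by (auto simp: lvar_power laurent_monomials_def split: if_splits
      intro!: exI[of _ "Poly_Mapping.single i (int n)"])


section \<open>Binary forms\<close>

definition binary_monomials :: "nat \<Rightarrow> param mpoly set" where
  "binary_monomials d = {theta 0 ^ i * theta 1 ^ j |i j. i + j = d}"

lemma binary_monomialsI: "i + j = d \<Longrightarrow> theta 0 ^ i * theta 1 ^ j \<in> binary_monomials d"
  unfolding binary_monomials_def by blast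

text \<open>
  The image of the variable belonging to the path \<open>p\<close> once \<open>z\<close> is replaced by
  \<open>\<theta>\<^sub>0 + \<theta>\<^sub>1\<close>. The degree \<open>d\<close> is a parameter of its own because a subtree of a tree has to be
  homogenised to a degree that may exceed the depth of the subtree.
\<close>
definition path_form :: "nat \<Rightarrow> nat list \<Rightarrow> param mpoly" where
  "path_form d p = (theta 0 + theta 1) ^ (d - length p) * (\<Prod>i\<leftarrow>p. theta i)"

definition path_space :: "nat \<Rightarrow> tree \<Rightarrow> param mpoly set" where
  "path_space d T = mpoly.span (path_form d ` set (paths T))"

lemma path_form_Cons: "path_form (Suc d) (i # p) = theta i * path_form d p"
  by (simp add: path_form_def mult_ac)

lemma mult_span_subset:
  assumes "x \<in> mpoly.span A" "mpoly.subspace S" "\<And>y. y \<in> A \<Longrightarrow> a * y \<in> S"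
  shows "a * x \<in> S"
  using assms(1)
proof (induction rule: mpoly.span_induct_alt)
  case base
  show ?case using mpoly.subspace_0[OF assms(2)] by simp
next
  case (step c x y)
  have "const c * (a * x) + a * y \<in> S"
    using step assms(3) by (intro mpoly.subspace_add mpoly.subspace_scale assms(2)) auto
  then show ?case by (simp add: algebra_simps)
qed

lemma theta_mult_span_binary_monomials:
  assumes "i < 2" "x \<in> mpoly.span (binary_monomials d)"
  shows "theta i * x \<in> mpoly.span (binary_monomials (Suc d))"
  using assms(2) mpoly.subspace_span
proof (rule mult_span_subset)
  fix y assume "y \<in> binary_monomials d"
  then obtain k l where y: "y = theta 0 ^ k * theta 1 ^ l" "k + l = d"
    by (auto simp: binary_monomials_def)
  have "theta i * y \<in> binary_monomials (Suc d)"
  proof (cases "i = 0")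
    case True
    then have "theta i * y = theta 0 ^ Suc k * theta 1 ^ l" using y by (simp add: mult_ac)
    then show ?thesis using y(2) unfolding binary_monomials_def by fastforce
  next
    case False
    then have "theta i * y = theta 0 ^ k * theta 1 ^ Suc l" using y assms(1)
      by (simp add: mult_ac less_2_cases_iff)
    then show ?thesis using y(2) unfolding binary_monomials_def by fastforce
  qed
  then show "theta i * y \<in> mpoly.span (binary_monomials (Suc d))" by (rule mpoly.span_base)
qed

lemma path_form_in_span_binary_monomials:
  assumes "length p \<le> d" "set p \<subseteq> {..<2}"
  shows "path_form d p \<in> mpoly.span (binary_monomials d)"
  using assms
proof (induction p arbitrary: d)
  case Nil
  have "(theta 0 + theta 1) ^ d \<in> mpoly.span (binary_monomials d)"
  proof (induction d)
    case 0
    show ?case by (rule mpoly.span_base) (simp add: binary_monomials_def)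
  next
    case (Suc d)
    then show ?case
      using theta_mult_span_binary_monomials[OF _ Suc.IH, of 0]
        theta_mult_span_binary_monomials[OF _ Suc.IH, of 1]
      by (simp add: distrib_right mpoly.span_add)
  qed
  then show ?case by (simp add: path_form_def)
next
  case (Cons i p)
  then obtain e where "d = Suc e" by (cases d) auto
  then show ?case using Cons
    by (auto simp: path_form_Cons intro!: theta_mult_span_binary_monomials)
qed

text \<open>
  Modulo the multiples of \<open>a\<close>, the form \<open>b * (a + b) ^ d\<close> is \<open>b ^ Suc d\<close>, the only monomial of
  degree \<open>Suc d\<close> in \<open>a\<close> and \<open>b\<close> that is not divisible by \<open>a\<close>.
\<close>
lemma subspace_contains_forms:
  fixes a b :: "'v mpoly"
  assumes S: "mpoly.subspace S"
    and a: "\<And>i j. i + j = d \<Longrightarrow> a * (a ^ i * b ^ j) \<in> S"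
    and b: "b * (a + b) ^ d \<in> S"
    and ij: "i + j = Suc d"
  shows "a ^ i * b ^ j \<in> S"
proof (cases i)
  case (Suc i')
  then show ?thesis using a[of i' j] ij by (simp add: mult.assoc)
next
  case 0
  \<comment> \<open>\<open>R\<close> collects the terms of the expansion of \<open>b * (a + b) ^ d\<close> that are divisible by \<open>a\<close>.\<close>
  define R where "R = (\<Sum>k<d. b * (of_nat (d choose Suc k) * a ^ Suc k * b ^ (d - Suc k)))"
  have "R \<in> S"
    unfolding R_def
  proof (rule mpoly.subspace_sum[OF S])
    fix k assume "k \<in> {..<d}"
    then have "const (of_nat (d choose Suc k)) * (a * (a ^ k * b ^ (d - k))) \<in> S"
      by (intro mpoly.subspace_scale[OF S] a) simp
    moreover have "b ^ (d - k) = b * b ^ (d - Suc k)"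
      using \<open>k \<in> {..<d}\<close> by (simp add: Suc_diff_Suc flip: power_Suc)
    ultimately show "b * (of_nat (d choose Suc k) * a ^ Suc k * b ^ (d - Suc k)) \<in> S"
      by (simp add: const_of_nat mult_ac)
  qed
  moreover have "b * (a + b) ^ d = b ^ Suc d + R"
    by (simp add: R_def binomial_ring lessThan_Suc_atMost[symmetric] sum.lessThan_Suc_shift
        distrib_left sum_distrib_left del: sum.lessThan_Suc)
  ultimately have "b ^ Suc d \<in> S"
    using mpoly.subspace_diff[OF S b] by fastforce
  then show ?thesis using 0 ij by simp
qed

section \<open>Binary one-stage trees\<close>

lemma binary_tree_induct [consumes 1, case_names Leaf Node]:
  assumes "one_stage 2 T" "P Leaf"
    and "\<And>A B. one_stage 2 A \<Longrightarrow> one_stage 2 B \<Longrightarrow> P A \<Longrightarrow> P B \<Longrightarrow> P (Node [A, B])"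
  shows "P T"
  using assms(1)
proof (induction T)
  case (Node ts)
  then have "length ts = 2" by simp
  then obtain A B where "ts = [A, B]"
    by (auto simp: length_Suc_conv numeral_2_eq_2)
  then show ?case using Node assms(3) by simp
qed (rule assms(2))

lemma set_paths_Node:
  "set (paths (Node [A, B])) = (#) 0 ` set (paths A) \<union> (#) 1 ` set (paths B)"
  by (simp add: upt_rec)

lemma paths_nonempty: "one_stage 2 T \<Longrightarrow> paths T \<noteq> []"
  by (induction rule: binary_tree_induct) (simp_all add: upt_rec)

lemma length_path_le_depth: "p \<in> set (paths T) \<Longrightarrow> length p \<le> depth T"
  by (simp add: depth_def)

lemma depth_Leaf: "depth Leaf = 0"
  by (simp add: depth_def)

lemma depth_Node:
  assumes "one_stage 2 A" "one_stage 2 B"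
  shows "depth (Node [A, B]) = Suc (max (depth A) (depth B))"
proof -
  let ?L = "\<lambda>T. length ` set (paths T)"
  have "?L (Node [A, B]) = Suc ` (?L A \<union> ?L B)"
    by (auto simp: set_paths_Node image_image image_Un)
  then have "depth (Node [A, B]) = Suc (Max (?L A \<union> ?L B))"
    using paths_nonempty[OF assms(1)]
    by (simp add: depth_def mono_Max_commute[symmetric] mono_Suc)
  then show ?thesis
    using paths_nonempty assms by (simp add: depth_def Max_Un)
qed

lemma path_entries: "one_stage 2 T \<Longrightarrow> p \<in> set (paths T) \<Longrightarrow> set p \<subseteq> {..<2}"
proof (induction arbitrary: p rule: binary_tree_induct)
  case (Node A B)
  then show ?case unfolding set_paths_Node by fastforce
qed simp

lemma theta_mult_path_space:
  "x \<in> path_space d A \<Longrightarrow> theta 0 * x \<in> path_space (Suc d) (Node [A, B])"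
  "y \<in> path_space d B \<Longrightarrow> theta 1 * y \<in> path_space (Suc d) (Node [A, B])"
  unfolding path_space_def
  by (erule mult_span_subset[OF _ mpoly.subspace_span],
      rule mpoly.span_base, auto simp: set_paths_Node simp flip: path_form_Cons)+

text \<open>
  Summing the path forms over all leaves telescopes to the full power: at each inner vertex the
  two branches contribute \<open>\<theta>\<^sub>0 + \<theta>\<^sub>1\<close> times a power that is already obtained. (For
  \<open>\<theta>\<^sub>0 + \<theta>\<^sub>1 = 1\<close> this says that the leaf probabilities add up to one.)
\<close>
lemma power_in_path_space:
  "one_stage 2 T \<Longrightarrow> depth T \<le> d \<Longrightarrow> (theta 0 + theta 1) ^ d \<in> path_space d T"
proof (induction arbitrary: d rule: binary_tree_induct)
  case Leaf
  then show ?case by (auto simp: path_space_def path_form_def intro: mpoly.span_base)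
next
  case (Node A B)
  then obtain e where d: "d = Suc e" and e: "depth A \<le> e" "depth B \<le> e"
    by (cases d) (auto simp: depth_Node)
  have "theta 0 * (theta 0 + theta 1) ^ e + theta 1 * (theta 0 + theta 1) ^ e \<in> path_space d (Node [A, B])"
    unfolding d using theta_mult_path_space Node.IH e
    by (metis mpoly.span_add path_space_def)
  then show ?case by (simp add: d distrib_right)
qed

text \<open>
  One of the two subtrees at the root has depth exactly one less than the tree. By induction it
  contributes all multiples of its edge label \<open>a\<close>. The other subtree, however small, contributes
  \<open>b\<close> times a power of \<open>a + b\<close>, which supplies the one missing monomial.
\<close>
lemma path_space_eq:
  assumes T: "one_stage 2 T"
  shows "path_space (depth T) T = mpoly.span (binary_monomials (depth T))"
proof
  show "path_space (depth T) T \<subseteq> mpoly.span (binary_monomials (depth T))"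
    unfolding path_space_def using length_path_le_depth path_entries[OF T]
    by (intro mpoly.span_minimal mpoly.subspace_span)
      (auto intro!: path_form_in_span_binary_monomials)
  have "binary_monomials (depth T) \<subseteq> path_space (depth T) T"
    using T
  proof (induction rule: binary_tree_induct)
    case Leaf
    show ?case
      by (auto simp: depth_Leaf binary_monomials_def path_space_def path_form_def intro: mpoly.span_base)
  next
    case (Node A B)
    let ?S = "path_space (depth (Node [A, B])) (Node [A, B])"
    define e where "e = max (depth A) (depth B)"
    have depth: "depth (Node [A, B]) = Suc e"
      using Node.hyps by (simp add: depth_Node e_def)
    have S: "mpoly.subspace ?S" by (simp add: path_space_def)
    have pow: "theta 0 * (theta 0 + theta 1) ^ e \<in> ?S" "theta 1 * (theta 0 + theta 1) ^ e \<in> ?S"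
      unfolding depth using Node.hyps
      by (intro theta_mult_path_space power_in_path_space; simp add: e_def)+
    have "theta 0 ^ i * theta 1 ^ j \<in> ?S" if ij: "i + j = Suc e" for i j
    proof (cases "depth A = e")
      case True
      have "theta 0 * (theta 0 ^ k * theta 1 ^ l) \<in> ?S" if "k + l = e" for k l
      proof -
        have "theta 0 ^ k * theta 1 ^ l \<in> binary_monomials e"
          using that unfolding binary_monomials_def by blast
        then have "theta 0 ^ k * theta 1 ^ l \<in> path_space e A"
          using Node.IH(1) True by blast
        then show ?thesis unfolding depth by (rule theta_mult_path_space)
      qed
      from subspace_contains_forms[OF S this pow(2) ij] show ?thesis .
    next
      case False
      then have "depth B = e" by (simp add: e_def max_def split: if_splits)
      have "theta 1 * (theta 1 ^ k * theta 0 ^ l) \<in> ?S" if "k + l = e" for k l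
      proof -
        have "theta 0 ^ l * theta 1 ^ k \<in> binary_monomials e"
          using that by (intro binary_monomialsI) simp
        then have "theta 0 ^ l * theta 1 ^ k \<in> path_space e B"
          using Node.IH(2) \<open>depth B = e\<close> by blast
        then show ?thesis
          unfolding depth mult.commute[of "theta 1 ^ k"] by (rule theta_mult_path_space)
      qed
      moreover have "theta 0 * (theta 1 + theta 0) ^ e \<in> ?S"
        using pow(1) by (simp only: add.commute)
      moreover have "j + i = Suc e" using ij by simp
      ultimately have "theta 1 ^ j * theta 0 ^ i \<in> ?S"
        by (rule subspace_contains_forms[OF S])
      then show ?thesis by (simp add: mult.commute)
    qed
    then show ?case by (auto simp: binary_monomials_def depth)
  qed
  then show "mpoly.span (binary_monomials (depth T)) \<subseteq> path_space (depth T) T"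
    by (intro mpoly.span_minimal) (simp_all add: path_space_def)
qed

section \<open>The Veronese parametrisation and toric structure\<close>

text \<open>
  The parametrisation under the identification of the target ring with the polynomials in
  \<open>\<theta>\<^sub>0, \<theta>\<^sub>1\<close>.
\<close>
definition subst_phi :: "tree \<Rightarrow> nat mpoly \<Rightarrow> param mpoly" where
  "subst_phi T = alg_ext (\<lambda>r. path_form (depth T) (paths T ! r))"

lemma identify_phi: "identify 2 (phi 2 T f) = subst_phi T f"
proof -
  have "(\<Sum>i<2. theta i) = theta 0 + theta 1" by (simp add: numeral_2_eq_2)
  then show ?thesis
    by (simp add: phi_def identify_coset subst_phi_def path_form_def Let_def alg_ext_comp
        subst_Z_def[of 2] alg_ext_mult alg_ext_power alg_ext_prod_list theta_def)
qed

lemma nth_path_entries: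
  assumes "one_stage 2 T" "r < num_paths T"
  shows "set (paths T ! r) \<subseteq> {..<2}"
  using assms by (intro path_entries) (auto simp: num_paths_def)

lemma kernel_phi:
  assumes T: "one_stage 2 T"
  shows "a_kernel (ring_p (num_paths T)) (target_ring 2) (phi 2 T)
       = {f \<in> carrier (ring_p (num_paths T)). subst_phi T f = 0}"
proof -
  let ?g = "\<lambda>r. let p = paths T ! r in var Z ^ (depth T - length p) * (\<Prod>i\<leftarrow>p. theta i)"
  have "phi 2 T f = theta_ideal 2 \<longleftrightarrow> subst_phi T f = 0" if "f \<in> carrier (ring_p (num_paths T))" for f
  proof -
    have "alg_ext ?g f \<in> carrier (ring_Theta_Z 2)"
      using that unfolding ring_p_def ring_Theta_Z_def
    proof (rule alg_ext_in_carrier)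
      fix r assume "r \<in> {..<num_paths T}"
      then show "?g r \<in> carrier (poly_ring (insert Z (Theta ` {..<2})))"
        using nth_path_entries[OF T, of r] unfolding Let_def
        by (intro exp_ring_mult exp_ring_power exp_ring_prod_list theta_in_carrier exp_ring_var) auto
    qed
    then show ?thesis
      unfolding identify_phi[symmetric] by (simp add: phi_def identify_coset coset_eq_theta_ideal_iff)
  qed
  then show ?thesis
    by (auto simp: a_kernel_def' target_ring_def FactRing_def)
qed

lemma span_path_forms:
  assumes "one_stage 2 T"
  shows "mpoly.span ((\<lambda>r. path_form (depth T) (paths T ! r)) ` {..<num_paths T})
       = mpoly.span (binary_monomials (depth T))"
proof -
  have "set (paths T) = (!) (paths T) ` {..<num_paths T}"
    by (auto simp: num_paths_def set_conv_nth)
  then show ?thesis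
    using path_space_eq[OF assms] by (simp add: path_space_def image_image)
qed

lemma image_subst_phi:
  assumes T: "one_stage 2 T"
  shows "subst_phi T ` carrier (ring_p (num_paths T)) = veronese_algebra 2 (depth T)"
proof -
  let ?h = "\<lambda>i. \<Prod>j<2. theta j ^ (i ! j)"
  have "?h ` multi_indices 2 d = binary_monomials d" for d
  proof
    show "?h ` multi_indices 2 d \<subseteq> binary_monomials d"
    proof (rule image_subsetI)
      fix x assume "x \<in> multi_indices 2 d"
      then obtain i j where "x = [i, j]" "i + j = d"
        by (auto simp: multi_indices_def length_Suc_conv numeral_2_eq_2)
      moreover from this have "?h x = theta 0 ^ i * theta 1 ^ j"
        by (simp add: numeral_2_eq_2)
      ultimately show "?h x \<in> binary_monomials d"
        unfolding binary_monomials_def by blast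
    qed
    show "binary_monomials d \<subseteq> ?h ` multi_indices 2 d"
    proof
      fix m assume "m \<in> binary_monomials d"
      then obtain i j where "m = theta 0 ^ i * theta 1 ^ j" "i + j = d"
        by (auto simp: binary_monomials_def)
      then show "m \<in> ?h ` multi_indices 2 d"
        by (intro image_eqI[of _ _ "[i, j]"]) (simp_all add: multi_indices_def numeral_2_eq_2)
    qed
  qed
  then show ?thesis
    unfolding subst_phi_def ring_p_def veronese_algebra_def veronese_def
    by (intro alg_ext_image_eq_if_span_eq) (simp add: span_path_forms[OF T])
qed

text \<open>
  The linear forms have a basis whose elements are parametrised by monomials, as the monomials of
  degree \<open>depth T\<close> span the same space as the path forms. Composing the parametrisation with the
  inclusion of polynomials into Laurent polynomials leaves its kernel unchanged.
\<close>
lemma toric_structure: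
  assumes T: "one_stage 2 T"
  shows "has_toric_structure 2 T"
proof -
  let ?n = "num_paths T"
  \<comment> \<open>Injective on \<open>\<theta>\<^sub>0, \<theta>\<^sub>1\<close>, the variables of the path forms; \<open>0\<close> at \<open>Z\<close> is a default.\<close>
  define enc where "enc v = (case v of Theta i \<Rightarrow> i | Z \<Rightarrow> 0)" for v
  let ?\<iota> = "alg_ext (\<lambda>v. lvar (enc v))"
  let ?\<psi> = "alg_ext (\<lambda>r. ?\<iota> (path_form (depth T) (paths T ! r)))"
  have \<psi>: "?\<psi> f = ?\<iota> (subst_phi T f)" for f
    by (simp add: subst_phi_def alg_ext_comp)
  have inj: "inj_on enc (Theta ` {..<2})" by (auto simp: inj_on_def enc_def)
  have form_carrier: "path_form (depth T) (paths T ! r) \<in> carrier (poly_ring (Theta ` {..<2}))"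
    if "r < ?n" for r
    using nth_path_entries[OF T that] unfolding path_form_def theta_def
    by (intro exp_ring_mult exp_ring_power exp_ring_prod_list exp_ring_add exp_ring_var) auto
  have "theta 0 ^ depth T * theta 1 ^ 0 \<in> binary_monomials (depth T)"
    unfolding binary_monomials_def by fastforce
  then have "binary_monomials (depth T) \<noteq> {}" by blast
  then obtain l where l: "linear_forms_basis ?n l"
    "\<And>i. i < ?n \<Longrightarrow> subst_phi T (l i) \<in> binary_monomials (depth T)"
    unfolding subst_phi_def using toric_if_image_spanned_by_monomials[OF span_path_forms[OF T]] by blast
  have "?\<psi> \<in> alg_hom (ring_p ?n) (laurent_ring {..<2})"
    unfolding ring_p_def
  proof (rule alg_ext_alg_hom)
    fix r assume "r \<in> {..<?n}"
    then show "?\<iota> (path_form (depth T) (paths T ! r)) \<in> carrier (laurent_ring {..<2})"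
      by (intro alg_ext_in_carrier[OF form_carrier])
        (auto simp: enc_def lvar_def intro: exp_ring_single)
  qed
  moreover have "?\<psi> (l i) \<in> laurent_monomials 2" if "i < ?n" for i
    using l(2)[OF that] unfolding \<psi>
    by (auto simp: binary_monomials_def alg_ext_mult alg_ext_power theta_def enc_def
        intro!: laurent_monomials_mult lvar_power_laurent_monomial)
  moreover have "subst_phi T f = 0 \<longleftrightarrow> ?\<psi> f = 0" if "f \<in> carrier (ring_p ?n)" for f
    unfolding \<psi>
    using that alg_ext_in_carrier[of f "{..<?n}", OF _ form_carrier]
    by (subst alg_ext_lvar_eq_zero_iff[OF inj]) (auto simp: subst_phi_def ring_p_def)
  then have "a_kernel (ring_p ?n) (target_ring 2) (phi 2 T) = a_kernel (ring_p ?n) (laurent_ring {..<2}) ?\<psi>"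
    unfolding kernel_phi[OF T] by (auto simp: a_kernel_def')
  ultimately show ?thesis
    unfolding has_toric_structure_def toric_after_linear_change_def using l(1) by blast
qed

theorem theorem6p5:
  fixes d :: nat and T :: tree
  assumes "d \<ge> 1" and "T \<in> one_stage_trees 2 d"
  shows "has_toric_structure 2 T \<and>
    identify 2 ` phi 2 T ` carrier (ring_p (num_paths T)) = veronese_algebra 2 d"
proof -
  have "one_stage 2 T" "depth T = d" using assms(2) by (auto simp: one_stage_trees_def)
  then show ?thesis
    using toric_structure image_subst_phi by (auto simp: image_image identify_phi)
qed

end
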